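(* Let $A = A_{st} + A_{\mathcal I}\epsilon \in \mathbb{DQ}^{n\times n}$ be a Hermitian dual quaternion matrix with $A_{st}\neq O$. (i) Every right eigenvalue $\lambda$ of $A$ is a dual number, hence an eigenvalue of $A$, and its standard part $\lambda_{st}$ is a right eigenvalue of the quaternion Hermitian matrix $A_{st}$. Furthermore, if $\lambda = \lambda_{st} + \lambda_{\mathcal I}\epsilon$ and $\mathbf{x} = \mathbf{x}_{st} + \mathbf{x}_{\mathcal I}\epsilon \in \mathbb{DQ}^n$ (with $\mathbf{x}_{st},\mathbf{x}_{\mathcal I}\in\mathbb{Q}^n$) is an eigenvector of $A$ associated with $\lambda$, then $$\lambda_{\mathcal I} = \frac{\mathbf{x}_{st}^* A_{\mathcal I}\mathbf{x}_{st}}{\mathbf{x}_{st}^*\mathbf{x}_{st}}.$$ (ii) $A$ has at most $n$ dual number eigenvalues and no other right eigenvalues. (iii) If $A$ is positive semidefinite, then every eigenvalue of $A$ is a nonnegative dual number, and $A_{st}$ is positive semidefinite. (iv) If $A$ is positive definite, then every eigenvalue of $A$ is an appreciable positive dual number, and $A_{st}$ is positive definite.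
   Context: $\mathbb{Q}$ denotes the real quaternions and $q^*$ the quaternion conjugate. $\epsilon$ is the infinitesimal unit: $\epsilon\neq 0$, $\epsilon^2=0$, and $\epsilon$ commutes with all quaternions. A dual number is $q=q_{st}+q_{\mathcal I}\epsilon$ with $q_{st},q_{\mathcal I}\in\mathbb{R}$; the set of dual numbers is $\mathbb{D}$. A dual quaternion is $q=q_{st}+q_{\mathcal I}\epsilon$ with $q_{st},q_{\mathcal I}\in\mathbb{Q}$ (standard part and infinitesimal part); the set of these is $\mathbb{DQ}$. The conjugate is $q^*=q_{st}^*+q_{\mathcal I}^*\epsilon$. A dual quaternion (in particular a dual number) is appreciable if $q_{st}\ne0$; a vector $\mathbf{x}\in\mathbb{DQ}^n$ is appreciable if at least one component is appreciable, i.e. $\mathbf{x}_{st}\neq\mathbf{0}$. Vectors and matrices over $\mathbb{DQ}$ are written $\mathbf{x}=\mathbf{x}_{st}+\mathbf{x}_{\mathcal I}\epsilon$, $A=A_{st}+A_{\mathcal I}\epsilon$ with quaternion parts; $^*$ on vectors and matrices denotes conjugate transpose, and $A$ is Hermitian if $A^*=A$. Total order on dual numbers: $p\le q$ iff $p_{st}<q_{st}$, or $p_{st}=q_{st}$ and $p_{\mathcal I}\le q_{\mathcal I}$. Positive means $>0$, nonnegative means $\ge0$ in this order. Right eigenvalue of a quaternion matrix $A\in\mathbb{Q}^{n\times n}$: $\lambda\in\mathbb{Q}$ with $A\mathbf{x}=\mathbf{x}\lambda$ for some nonzero $\mathbf{x}\in\mathbb{Q}^n$. Right eigenvalue of $A\in\mathbb{DQ}^{n\times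 n}$: $\lambda\in\mathbb{DQ}$ such that $A\mathbf{x}=\mathbf{x}\lambda$ for some appreciable $\mathbf{x}\in\mathbb{DQ}^n$ (an associated right eigenvector). A right eigenvalue that is a dual number is called an eigenvalue, and $\mathbf{x}$ an associated eigenvector. For Hermitian $A\in\mathbb{DQ}^{n\times n}$, $\mathbf{x}^*A\mathbf{x}$ is always a dual number. $A$ is positive semidefinite if $\mathbf{x}^*A\mathbf{x}\ge0$ for all $\mathbf{x}\in\mathbb{DQ}^n$, and positive definite if $\mathbf{x}^*A\mathbf{x}$ is positive and appreciable for all appreciable $\mathbf{x}\in\mathbb{DQ}^n$. A quaternion Hermitian matrix $A\in\mathbb{Q}^{n\times n}$ is positive semidefinite if $\mathbf{x}^*A\mathbf{x}\ge0$ for all $\mathbf{x}\in\mathbb{Q}^n$ and positive definite if $\mathbf{x}^*A\mathbf{x}>0$ for all nonzero $\mathbf{x}\in\mathbb{Q}^n$. *)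

theory Defs
  imports "HOL-Analysis.Analysis"
begin

section \<open>Rings with an involution\<close>

class involution_ring = ring_1 +
  fixes conjg :: "'a \<Rightarrow> 'a"
  assumes conjg_add: "conjg (x + y) = conjg x + conjg y"
    and conjg_mult: "conjg (x * y) = conjg y * conjg x"
    and conjg_conjg [simp]: "conjg (conjg x) = x"
begin

lemma conjg_zero [simp]: "conjg 0 = 0"
  using conjg_add[of 0 0] by simp

lemma conjg_sum: "conjg (sum f S) = (\<Sum>i\<in>S. conjg (f i))"
  by (induction S rule: infinite_finite_induct) (auto simp: conjg_add)

end

section \<open>Real quaternions\<close>

datatype quat = Quat (Re_q: real) (Im_i: real) (Im_j: real) (Im_k: real)

lemma quat_eq_iff:
  "p = q \<longleftrightarrow> Re_q p = Re_q q \<and> Im_i p = Im_i q \<and> Im_j p = Im_j q \<and> Im_k p = Im_k q"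
  by (auto intro: quat.expand)

instantiation quat :: ab_group_add
begin

definition "0 = Quat 0 0 0 0"
definition "p + q = Quat (Re_q p + Re_q q) (Im_i p + Im_i q) (Im_j p + Im_j q) (Im_k p + Im_k q)"
definition "- q = Quat (- Re_q q) (- Im_i q) (- Im_j q) (- Im_k q)"
definition "p - q = Quat (Re_q p - Re_q q) (Im_i p - Im_i q) (Im_j p - Im_j q) (Im_k p - Im_k q)"

instance
  by standard (simp_all add: quat_eq_iff zero_quat_def plus_quat_def uminus_quat_def minus_quat_def)

end

instantiation quat :: real_div_algebra
begin

definition "1 = Quat 1 0 0 0"

definition "p * q = Quat
  (Re_q p * Re_q q - Im_i p * Im_i q - Im_j p * Im_j q - Im_k p * Im_k q)
  (Re_q p * Im_i q + Im_i p * Re_q q + Im_j p * Im_k q - Im_k p * Im_j q)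
  (Re_q p * Im_j q - Im_i p * Im_k q + Im_j p * Re_q q + Im_k p * Im_i q)
  (Re_q p * Im_k q + Im_i p * Im_j q - Im_j p * Im_i q + Im_k p * Re_q q)"

definition "r *\<^sub>R q = Quat (r * Re_q q) (r * Im_i q) (r * Im_j q) (r * Im_k q)"

definition "inverse q =
  inverse ((Re_q q)\<^sup>2 + (Im_i q)\<^sup>2 + (Im_j q)\<^sup>2 + (Im_k q)\<^sup>2)
    *\<^sub>R Quat (Re_q q) (- Im_i q) (- Im_j q) (- Im_k q)"

definition "(p :: quat) div q = p * inverse q"

instance
proof
  fix p q s :: quat and a b :: real
  show "p * q * s = p * (q * s)"
    by (simp add: quat_eq_iff times_quat_def algebra_simps)
  show "(p + q) * s = p * s + q * s" "p * (q + s) = p * q + p * s"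
    by (simp_all add: quat_eq_iff times_quat_def plus_quat_def algebra_simps)
  show "1 * p = p" "p * 1 = p" "(0::quat) \<noteq> 1"
    by (simp_all add: quat_eq_iff times_quat_def one_quat_def zero_quat_def)
  show "a *\<^sub>R (p + q) = a *\<^sub>R p + a *\<^sub>R q" "(a + b) *\<^sub>R p = a *\<^sub>R p + b *\<^sub>R p"
    "a *\<^sub>R b *\<^sub>R p = (a * b) *\<^sub>R p" "1 *\<^sub>R p = p"
    "a *\<^sub>R p * q = a *\<^sub>R (p * q)" "p * a *\<^sub>R q = a *\<^sub>R (p * q)"
    by (simp_all add: quat_eq_iff times_quat_def plus_quat_def scaleR_quat_def algebra_simps)
  show "p div q = p * inverse q"
    by (rule divide_quat_def)
  show "inverse (0::quat) = 0"
    by (simp add: quat_eq_iff inverse_quat_def scaleR_quat_def zero_quat_def)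
  define N where "N = (Re_q p)\<^sup>2 + (Im_i p)\<^sup>2 + (Im_j p)\<^sup>2 + (Im_k p)\<^sup>2"
  define c where "c = Quat (Re_q p) (- Im_i p) (- Im_j p) (- Im_k p)"
  have inv: "inverse p = inverse N *\<^sub>R c"
    by (simp add: inverse_quat_def N_def c_def)
  have cp: "inverse N *\<^sub>R c * p = Quat (inverse N * N) 0 0 0"
    "p * (inverse N *\<^sub>R c) = Quat (inverse N * N) 0 0 0"
    by (simp_all add: quat_eq_iff times_quat_def scaleR_quat_def c_def N_def
        power2_eq_square algebra_simps)
  assume "p \<noteq> 0"
  then have "N \<noteq> 0"
    by (auto simp: N_def quat_eq_iff zero_quat_def add_nonneg_eq_0_iff)
  then show "inverse p * p = 1" "p * inverse p = 1"
    by (simp_all add: inv cp one_quat_def)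
qed

end

instantiation quat :: involution_ring
begin

definition "conjg q = Quat (Re_q q) (- Im_i q) (- Im_j q) (- Im_k q)"

instance
  by standard (simp_all add: quat_eq_iff conjg_quat_def times_quat_def plus_quat_def algebra_simps)

end

section \<open>Dual numbers over a ring\<close>

datatype 'a dual = Dual (std_part: 'a) (inf_part: 'a)

text \<open>
  \<open>Dual a b\<close> stands for \<open>a + b \<epsilon>\<close>: the type \<^typ>\<open>real dual\<close> is the ring of dual
  numbers, and \<^typ>\<open>quat dual\<close> is the ring of dual quaternions.
\<close>

lemma dual_eq_iff: "p = q \<longleftrightarrow> std_part p = std_part q \<and> inf_part p = inf_part q"
  by (auto intro: dual.expand)

instantiation dual :: (ab_group_add) ab_group_add
begin

definition "0 = Dual 0 0"
definition "p + q = Dual (std_part p + std_part q) (inf_part p + inf_part q)"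
definition "- p = Dual (- std_part p) (- inf_part p)"
definition "p - q = Dual (std_part p - std_part q) (inf_part p - inf_part q)"

instance
  by standard (simp_all add: dual_eq_iff zero_dual_def plus_dual_def uminus_dual_def minus_dual_def)

end

instantiation dual :: (ring_1) ring_1
begin

definition "1 = Dual 1 0"
definition "p * q =
  Dual (std_part p * std_part q) (std_part p * inf_part q + inf_part p * std_part q)"

instance
  by standard (simp_all add: dual_eq_iff zero_dual_def one_dual_def plus_dual_def times_dual_def
      algebra_simps)

end

instantiation dual :: (involution_ring) involution_ring
begin

definition "conjg p = Dual (conjg (std_part p)) (conjg (inf_part p))"

instance
  by standard (simp_all add: dual_eq_iff conjg_dual_def plus_dual_def times_dual_def
      conjg_add conjg_mult add.commute)

end

definition eps :: "'a::ring_1 dual" where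
  "eps = Dual 0 1"

lemma eps_facts:
  "(eps :: 'a::ring_1 dual) \<noteq> 0" "eps * eps = (0 :: 'a dual)" "eps * q = q * (eps :: 'a dual)"
  by (simp_all add: eps_def dual_eq_iff zero_dual_def times_dual_def)

lemma dual_decompose: "q = Dual (std_part q) 0 + Dual (inf_part q) 0 * (eps :: 'a::ring_1 dual)"
  by (simp add: eps_def dual_eq_iff plus_dual_def times_dual_def)

instantiation dual :: (linorder) linorder
begin

definition "p \<le> q \<longleftrightarrow>
  std_part p < std_part q \<or> std_part p = std_part q \<and> inf_part p \<le> inf_part q"
definition "(p :: 'a dual) < q \<longleftrightarrow> p \<le> q \<and> p \<noteq> q"

instance
  by standard (auto simp: less_eq_dual_def less_dual_def dual_eq_iff)

end

definition appreciable :: "'a::zero dual \<Rightarrow> bool" where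
  "appreciable q \<longleftrightarrow> std_part q \<noteq> 0"

definition of_dual :: "real dual \<Rightarrow> quat dual" where
  "of_dual d = Dual (of_real (std_part d)) (of_real (inf_part d))"

section \<open>Vectors and matrices\<close>

definition std_vec :: "'a dual ^ 'n \<Rightarrow> 'a ^ 'n" where
  "std_vec x = (\<chi> i. std_part (x $ i))"

definition std_mat :: "'a dual ^ 'n ^ 'm \<Rightarrow> 'a ^ 'n ^ 'm" where
  "std_mat A = (\<chi> i j. std_part (A $ i $ j))"

definition inf_mat :: "'a dual ^ 'n ^ 'm \<Rightarrow> 'a ^ 'n ^ 'm" where
  "inf_mat A = (\<chi> i j. inf_part (A $ i $ j))"

definition appreciable_vec :: "'a::zero dual ^ 'n \<Rightarrow> bool" where
  "appreciable_vec x \<longleftrightarrow> (\<exists>i. appreciable (x $ i))"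

lemma appreciable_vec_iff: "appreciable_vec x \<longleftrightarrow> std_vec x \<noteq> 0"
  by (auto simp: appreciable_vec_def appreciable_def std_vec_def vec_eq_iff)

definition conj_transpose :: "'a::involution_ring ^ 'n ^ 'm \<Rightarrow> 'a ^ 'm ^ 'n" where
  "conj_transpose A = (\<chi> i j. conjg (A $ j $ i))"

definition hermitian :: "'a::involution_ring ^ 'n ^ 'n \<Rightarrow> bool" where
  "hermitian A \<longleftrightarrow> conj_transpose A = A"

text \<open>\<open>row_col x y\<close> is \<open>x\<^sup>* y\<close>.\<close>

definition row_col :: "'a::involution_ring ^ 'n \<Rightarrow> 'a ^ 'n \<Rightarrow> 'a" where
  "row_col x y = (\<Sum>i\<in>UNIV. conjg (x $ i) * y $ i)"

text \<open>\<open>vec_rscale x l\<close> is \<open>x l\<close>, the scalar acting on the right; the library's \<open>*s\<close> acts on the left.\<close>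

definition vec_rscale :: "'a::times ^ 'n \<Rightarrow> 'a \<Rightarrow> 'a ^ 'n" where
  "vec_rscale x l = (\<chi> i. x $ i * l)"

section \<open>Right eigenvalues\<close>

definition quat_right_eigenvalue :: "quat ^ 'n ^ 'n \<Rightarrow> quat \<Rightarrow> bool" where
  "quat_right_eigenvalue A l \<longleftrightarrow> (\<exists>x. x \<noteq> 0 \<and> A *v x = vec_rscale x l)"

definition right_eigenvector :: "quat dual ^ 'n ^ 'n \<Rightarrow> quat dual \<Rightarrow> quat dual ^ 'n \<Rightarrow> bool" where
  "right_eigenvector A l x \<longleftrightarrow> appreciable_vec x \<and> A *v x = vec_rscale x l"

definition right_eigenvalue :: "quat dual ^ 'n ^ 'n \<Rightarrow> quat dual \<Rightarrow> bool" where
  "right_eigenvalue A l \<longleftrightarrow> (\<exists>x. right_eigenvector A l x)"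

definition eigenvector :: "quat dual ^ 'n ^ 'n \<Rightarrow> real dual \<Rightarrow> quat dual ^ 'n \<Rightarrow> bool" where
  "eigenvector A d x \<longleftrightarrow> right_eigenvector A (of_dual d) x"

definition eigenvalue :: "quat dual ^ 'n ^ 'n \<Rightarrow> real dual \<Rightarrow> bool" where
  "eigenvalue A d \<longleftrightarrow> right_eigenvalue A (of_dual d)"

section \<open>Positive (semi)definite Hermitian matrices\<close>

text \<open>
  For Hermitian \<open>A\<close> the value \<open>x\<^sup>* A x\<close> is real, respectively a dual number
  (\<open>quat_form_real\<close> and \<open>dual_form_dual_number\<close> below), but it has type
  \<^typ>\<open>quat\<close>, respectively \<^typ>\<open>quat dual\<close>.  The existential quantifiers only name
  the real or dual number it is, so that it can be compared with 0.
\<close>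

definition quat_psd :: "quat ^ 'n ^ 'n \<Rightarrow> bool" where
  "quat_psd A \<longleftrightarrow> hermitian A \<and>
     (\<forall>x. \<exists>r::real. row_col x (A *v x) = of_real r \<and> r \<ge> 0)"

definition quat_pd :: "quat ^ 'n ^ 'n \<Rightarrow> bool" where
  "quat_pd A \<longleftrightarrow> hermitian A \<and>
     (\<forall>x. x \<noteq> 0 \<longrightarrow> (\<exists>r::real. row_col x (A *v x) = of_real r \<and> r > 0))"

definition dual_psd :: "quat dual ^ 'n ^ 'n \<Rightarrow> bool" where
  "dual_psd A \<longleftrightarrow> hermitian A \<and>
     (\<forall>x. \<exists>d. row_col x (A *v x) = of_dual d \<and> d \<ge> 0)"

definition dual_pd :: "quat dual ^ 'n ^ 'n \<Rightarrow> bool" where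
  "dual_pd A \<longleftrightarrow> hermitian A \<and>
     (\<forall>x. appreciable_vec x \<longrightarrow>
        (\<exists>d. row_col x (A *v x) = of_dual d \<and> d > 0 \<and> appreciable d))"

lemma conjg_form:
  fixes A :: "'a::involution_ring ^ 'n ^ 'n"
  assumes "hermitian A"
  shows "conjg (row_col x (A *v x)) = row_col x (A *v x)"
proof -
  have A: "conjg (A $ i $ j) = A $ j $ i" for i j
    using assms unfolding hermitian_def conj_transpose_def by (metis vec_lambda_beta)
  have "conjg (row_col x (A *v x)) =
      (\<Sum>i\<in>UNIV. \<Sum>j\<in>UNIV. conjg (x $ j) * A $ j $ i * x $ i)"
    by (simp add: row_col_def matrix_vector_mult_def conjg_sum conjg_mult A sum_distrib_right
        sum_distrib_left mult.assoc)
  also have "\<dots> = (\<Sum>j\<in>UNIV. \<Sum>i\<in>UNIV. conjg (x $ j) * A $ j $ i * x $ i)"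
    by (rule sum.swap)
  also have "\<dots> = row_col x (A *v x)"
    by (simp add: row_col_def matrix_vector_mult_def sum_distrib_left mult.assoc)
  finally show ?thesis .
qed

lemma of_real_quat: "(of_real r :: quat) = Quat r 0 0 0"
  by (simp add: of_real_def scaleR_quat_def one_quat_def)

lemma quat_self_conjugate: "conjg q = q \<Longrightarrow> q = of_real (Re_q q)"
  by (simp add: conjg_quat_def quat_eq_iff of_real_quat)

lemma quat_form_real:
  "hermitian A \<Longrightarrow> \<exists>r. row_col x (A *v x) = (of_real r :: quat)"
  using conjg_form quat_self_conjugate by blast

lemma dual_form_dual_number:
  assumes "hermitian A"
  shows "\<exists>d. row_col x (A *v x) = of_dual d"
proof -
  define q where "q = row_col x (A *v x)"
  have "conjg q = q"
    unfolding q_def by (rule conjg_form[OF assms])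
  then have "conjg (std_part q) = std_part q" "conjg (inf_part q) = inf_part q"
    by (simp_all add: conjg_dual_def dual_eq_iff)
  then have "q = of_dual (Dual (Re_q (std_part q)) (Re_q (inf_part q)))"
    by (simp add: of_dual_def dual_eq_iff flip: quat_self_conjugate)
  then show ?thesis
    unfolding q_def by blast
qed

end

theory Submission
  imports Defs
begin

text \<open>
  Two identities carry the argument. Pairing \<open>A x = x \<lambda>\<close> with \<open>x\<close> gives \<open>x\<^sup>* A x = (x\<^sup>* x) \<lambda>\<close>, where both
  forms are dual numbers and \<open>x\<^sup>* x\<close> has positive standard part, so \<open>\<lambda>\<close> is a dual number with the sign of
  \<open>x\<^sup>* A x\<close>. Moving \<open>A\<close> across \<open>x\<^sup>* A y\<close> for eigenvalues \<open>\<lambda> \<noteq> \<mu>\<close> gives \<open>(\<lambda> - \<mu>) x\<^sup>* y = 0\<close>; as the nonzero dual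
  number \<open>\<lambda> - \<mu>\<close> is appreciable or a real multiple of \<open>\<epsilon>\<close>, the standard parts of \<open>x\<close> and \<open>y\<close> are orthogonal
  even when \<open>\<lambda>\<close> and \<open>\<mu>\<close> share their standard part. At most \<open>n\<close> nonzero vectors are pairwise orthogonal.
\<close>

section \<open>The sesquilinear product\<close>

lemma conjg_one [simp]: "conjg (1::'a::involution_ring) = 1"
  using conjg_mult[of 1 "conjg (1::'a)"] by simp

lemma conjg_diff: "conjg (x - y :: 'a::involution_ring) = conjg x - conjg y"
  using conjg_add[of "x - y" y] by (simp add: algebra_simps)

lemma row_col_add_right: "row_col x (y + z) = row_col x y + row_col x z"
  by (simp add: row_col_def distrib_left sum.distrib)

lemma row_col_diff_left: "row_col (x - y) z = row_col x z - row_col y z"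
  by (simp add: row_col_def conjg_diff left_diff_distrib sum_subtractf)

lemma row_col_diff_right: "row_col x (y - z) = row_col x y - row_col x z"
  by (simp add: row_col_def right_diff_distrib sum_subtractf)

lemma row_col_sum_left: "row_col (sum f S) y = (\<Sum>k\<in>S. row_col (f k) y)"
  by (induction S rule: infinite_finite_induct)
    (simp_all add: row_col_def conjg_add distrib_right sum.distrib)

lemma row_col_sum_right: "row_col x (sum f S) = (\<Sum>k\<in>S. row_col x (f k))"
  by (induction S rule: infinite_finite_induct)
    (simp_all add: row_col_def distrib_left sum.distrib)

lemma row_col_rscale_left: "row_col (vec_rscale x l) y = conjg l * row_col x y"
  by (simp add: row_col_def vec_rscale_def conjg_mult sum_distrib_left mult.assoc)

lemma row_col_rscale_right: "row_col x (vec_rscale y l) = row_col x y * l"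
  by (simp add: row_col_def vec_rscale_def sum_distrib_right mult.assoc)

lemma row_col_axis_left: "row_col (axis i 1) x = (x $ i :: 'a::involution_ring)"
proof -
  have "row_col (axis i 1) x = (\<Sum>j\<in>UNIV. if j = i then x $ j else 0)"
    unfolding row_col_def by (intro sum.cong) (auto simp: axis_def)
  then show ?thesis by simp
qed

lemma conjg_row_col: "conjg (row_col x y) = row_col y x"
  by (simp add: row_col_def conjg_sum conjg_mult)

lemma row_col_axis_right: "row_col x (axis i 1) = conjg (x $ i :: 'a::involution_ring)"
  by (metis conjg_row_col row_col_axis_left)

lemma hermitian_entry: "hermitian A \<Longrightarrow> conjg (A $ i $ j) = A $ j $ i"
  unfolding hermitian_def conj_transpose_def by (metis vec_lambda_beta)

lemma hermitian_row_col:
  fixes A :: "'a::involution_ring ^ 'n ^ 'n"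
  assumes "hermitian A"
  shows "row_col x (A *v y) = row_col (A *v x) y"
proof -
  have "row_col (A *v x) y = (\<Sum>i\<in>UNIV. \<Sum>j\<in>UNIV. conjg (x $ j) * A $ j $ i * y $ i)"
    by (simp add: row_col_def matrix_vector_mult_def conjg_sum conjg_mult
        hermitian_entry[OF assms] sum_distrib_right mult.assoc)
  also have "\<dots> = (\<Sum>j\<in>UNIV. \<Sum>i\<in>UNIV. conjg (x $ j) * A $ j $ i * y $ i)"
    by (rule sum.swap)
  also have "\<dots> = row_col x (A *v y)"
    by (simp add: row_col_def matrix_vector_mult_def sum_distrib_left mult.assoc)
  finally show ?thesis by simp
qed

section \<open>Orthogonal families of quaternion vectors\<close>

lemma conjg_of_real_quat [simp]: "conjg (of_real r :: quat) = of_real r"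
  by (simp add: conjg_quat_def of_real_quat)

text \<open>Reals are central in the quaternions. This is what allows a real factor standing to the
  right of a product \<open>row_col x y\<close> to be compared with one standing to its
  left.\<close>

lemma of_real_mult_commute_quat: "(q :: quat) * of_real r = of_real r * q"
  by (simp add: of_real_quat times_quat_def mult.commute)

definition quat_sqnorm :: "quat \<Rightarrow> real" where
  "quat_sqnorm q = (Re_q q)\<^sup>2 + (Im_i q)\<^sup>2 + (Im_j q)\<^sup>2 + (Im_k q)\<^sup>2"

lemma quat_sqnorm_nonneg: "quat_sqnorm q \<ge> 0"
  by (simp add: quat_sqnorm_def)

lemma quat_sqnorm_eq_0_iff: "quat_sqnorm q = 0 \<longleftrightarrow> q = 0"
  by (auto simp: quat_sqnorm_def quat_eq_iff zero_quat_def add_nonneg_eq_0_iff)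

lemma conjg_mult_self: "conjg q * q = of_real (quat_sqnorm q)"
  and mult_conjg_self: "q * conjg q = of_real (quat_sqnorm q)"
  by (simp_all add: quat_sqnorm_def conjg_quat_def times_quat_def of_real_quat power2_eq_square)

definition vec_sqnorm :: "quat ^ 'n \<Rightarrow> real" where
  "vec_sqnorm x = (\<Sum>i\<in>UNIV. quat_sqnorm (x $ i))"

lemma row_col_self: "row_col x x = of_real (vec_sqnorm x)"
  by (simp add: row_col_def vec_sqnorm_def conjg_mult_self)

lemma vec_sqnorm_nonneg: "vec_sqnorm x \<ge> 0"
  by (simp add: vec_sqnorm_def sum_nonneg quat_sqnorm_nonneg)

lemma vec_sqnorm_pos: "x \<noteq> 0 \<Longrightarrow> vec_sqnorm x > 0"
  using vec_sqnorm_nonneg[of x]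
  by (auto simp: vec_sqnorm_def sum_nonneg_eq_0_iff quat_sqnorm_nonneg quat_sqnorm_eq_0_iff
      vec_eq_iff less_le)

text \<open>Bessel's inequality for the \<open>i\<close>-th standard basis vector. Subtracting from
  that vector its projection \<open>p\<close> onto the family leaves a residual whose squared norm
  is one minus the sum, and a squared norm is nonnegative.\<close>

lemma bessel_axis:
  fixes v :: "'b \<Rightarrow> quat ^ 'n"
  assumes "finite S" and nz: "\<And>s. s \<in> S \<Longrightarrow> v s \<noteq> 0"
    and orth: "\<And>s t. s \<in> S \<Longrightarrow> t \<in> S \<Longrightarrow> s \<noteq> t \<Longrightarrow> row_col (v s) (v t) = 0"
  shows "(\<Sum>s\<in>S. quat_sqnorm (v s $ i) / vec_sqnorm (v s)) \<le> 1"
proof -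
  \<comment> \<open>The Fourier coefficient of the basis vector along \<open>v s\<close>, since
    \<open>row_col (v s) (axis i 1)\<close> is \<open>conjg (v s $ i)\<close>. It acts from the
    right, as the product is right-linear in its second argument.\<close>
  define c where "c s = of_real (inverse (vec_sqnorm (v s))) * conjg (v s $ i)" for s
  define p where "p = (\<Sum>s\<in>S. vec_rscale (v s) (c s))"
  \<comment> \<open>the component of the basis vector orthogonal to the family\<close>
  define w where "w = axis i 1 - p"
  have "row_col (v s) w = 0" if "s \<in> S" for s
  proof -
    have "row_col (v s) p = (\<Sum>t\<in>S. row_col (v s) (v t) * c t)"
      by (simp add: p_def row_col_sum_right row_col_rscale_right)
    also have "\<dots> = (\<Sum>t\<in>S. if t = s then row_col (v s) (v s) * c s else 0)"
      using orth that by (intro sum.cong) auto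
    also have "\<dots> = row_col (v s) (v s) * c s"
      using that \<open>finite S\<close> by simp
    also have "\<dots> = of_real (vec_sqnorm (v s) * inverse (vec_sqnorm (v s))) * conjg (v s $ i)"
      unfolding row_col_self c_def of_real_mult mult.assoc ..
    also have "\<dots> = conjg (v s $ i)"
      using vec_sqnorm_pos[OF nz[OF that]] by simp
    finally show ?thesis
      by (simp add: w_def row_col_diff_right row_col_axis_right)
  qed
  then have "row_col p w = 0"
    by (simp add: p_def row_col_sum_left row_col_rscale_left)
  \<comment> \<open>Expand only the left \<open>w\<close>: its part \<open>p\<close> is orthogonal
    to \<open>w\<close>, and pairing with the basis vector reads off a coordinate.\<close>
  then have "row_col w w = w $ i"
    by (subst (1) w_def) (simp add: row_col_diff_left row_col_axis_left)
  moreover have "v s $ i * c s = of_real (quat_sqnorm (v s $ i) / vec_sqnorm (v s))" for s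
  proof -
    have "v s $ i * c s = of_real (inverse (vec_sqnorm (v s))) * (v s $ i * conjg (v s $ i))"
      unfolding c_def by (metis mult.assoc of_real_mult_commute_quat)
    then show ?thesis
      by (metis divide_inverse mult.commute mult_conjg_self of_real_mult)
  qed
  then have "p $ i = of_real (\<Sum>s\<in>S. quat_sqnorm (v s $ i) / vec_sqnorm (v s))"
    by (simp add: p_def vec_rscale_def)
  then have "w $ i = of_real (1 - (\<Sum>s\<in>S. quat_sqnorm (v s $ i) / vec_sqnorm (v s)))"
    by (simp add: w_def axis_def)
  ultimately have "of_real (vec_sqnorm w)
      = (of_real (1 - (\<Sum>s\<in>S. quat_sqnorm (v s $ i) / vec_sqnorm (v s))) :: quat)"
    by (metis row_col_self)
  then have "vec_sqnorm w = 1 - (\<Sum>s\<in>S. quat_sqnorm (v s $ i) / vec_sqnorm (v s))"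
    unfolding of_real_eq_iff .
  with vec_sqnorm_nonneg[of w] show ?thesis by simp
qed

text \<open>Double counting: after normalisation each vector contributes 1 in total over all
  coordinates, while by \<open>bessel_axis\<close> each coordinate receives at most 1 from the whole
  family.\<close>

lemma card_orthogonal_le:
  fixes v :: "'b \<Rightarrow> quat ^ 'n"
  assumes "finite S" and nz: "\<And>s. s \<in> S \<Longrightarrow> v s \<noteq> 0"
    and "\<And>s t. s \<in> S \<Longrightarrow> t \<in> S \<Longrightarrow> s \<noteq> t \<Longrightarrow> row_col (v s) (v t) = 0"
  shows "card S \<le> CARD('n)"
proof -
  have "real (card S) = (\<Sum>s\<in>S. vec_sqnorm (v s) / vec_sqnorm (v s))"
    using vec_sqnorm_pos[OF nz] by (simp add: less_imp_neq[symmetric])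
  also have "\<dots> = (\<Sum>s\<in>S. \<Sum>i\<in>UNIV. quat_sqnorm (v s $ i) / vec_sqnorm (v s))"
    by (subst (1) vec_sqnorm_def) (simp add: sum_divide_distrib)
  also have "\<dots> = (\<Sum>i\<in>UNIV. \<Sum>s\<in>S. quat_sqnorm (v s $ i) / vec_sqnorm (v s))"
    by (rule sum.swap)
  also have "\<dots> \<le> (\<Sum>i\<in>(UNIV :: 'n set). 1)"
    by (intro sum_mono bessel_axis assms)
  finally show ?thesis by simp
qed

section \<open>Standard and infinitesimal parts\<close>

definition inf_vec :: "'a dual ^ 'n \<Rightarrow> 'a ^ 'n" where
  "inf_vec x = (\<chi> i. inf_part (x $ i))"

lemma dual_part_simps [simp]:
  "std_part 0 = 0" "inf_part 0 = 0"
  "std_part (p + q) = std_part p + std_part q" "inf_part (p + q) = inf_part p + inf_part q"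
  by (simp_all add: zero_dual_def plus_dual_def)

lemma dual_part_mult [simp]:
  "std_part (p * q) = std_part p * std_part q"
  "inf_part (p * q) = std_part p * inf_part q + inf_part p * std_part q"
  by (simp_all add: times_dual_def)

lemma dual_part_conjg [simp]:
  "std_part (conjg p) = conjg (std_part p)" "inf_part (conjg p) = conjg (inf_part p)"
  by (simp_all add: conjg_dual_def)

lemma dual_part_sum:
  "std_part (sum f S) = (\<Sum>k\<in>S. std_part (f k))" "inf_part (sum f S) = (\<Sum>k\<in>S. inf_part (f k))"
  by (induction S rule: infinite_finite_induct) auto

lemma std_part_row_col: "std_part (row_col x y) = row_col (std_vec x) (std_vec y)"
  by (simp add: row_col_def std_vec_def dual_part_sum)

lemma std_vec_mult: "std_vec (A *v x) = std_mat A *v std_vec x"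
  and inf_vec_mult: "inf_vec (A *v x) = std_mat A *v inf_vec x + inf_mat A *v std_vec x"
  by (simp_all add: std_vec_def inf_vec_def std_mat_def inf_mat_def matrix_vector_mult_def
      dual_part_sum sum.distrib vec_eq_iff)

lemma std_vec_rscale: "std_vec (vec_rscale x l) = vec_rscale (std_vec x) (std_part l)"
  and inf_vec_rscale: "inf_vec (vec_rscale x l) =
    vec_rscale (std_vec x) (inf_part l) + vec_rscale (inf_vec x) (std_part l)"
  by (simp_all add: std_vec_def inf_vec_def vec_rscale_def vec_eq_iff)

lemma hermitian_std_mat: "hermitian A \<Longrightarrow> hermitian (std_mat A)"
  by (simp add: hermitian_def conj_transpose_def std_mat_def vec_eq_iff)
    (metis dual_part_conjg(1))

lemma std_vec_surj: "\<exists>y :: 'a::zero dual ^ 'n. std_vec y = x"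
  by (rule exI[of _ "\<chi> i. Dual (x $ i) 0"]) (simp add: std_vec_def vec_eq_iff)

lemma of_dual_parts [simp]:
  "std_part (of_dual d) = of_real (std_part d)" "inf_part (of_dual d) = of_real (inf_part d)"
  by (simp_all add: of_dual_def)

lemma conjg_of_dual [simp]: "conjg (of_dual d) = of_dual d"
  by (simp add: dual_eq_iff)

lemma of_dual_mult: "of_dual (d * e) = of_dual d * of_dual e"
  by (simp add: dual_eq_iff)

lemma of_dual_eq_iff [simp]: "of_dual d = of_dual e \<longleftrightarrow> d = e"
  by (simp add: dual_eq_iff)

text \<open>The product is self-conjugate, so both of its parts are real; the standard part is the
  squared norm of the nonzero vector \<open>std_vec x\<close>.\<close>

lemma row_col_self_of_dual:
  assumes "appreciable_vec x"
  obtains a where "row_col x x = of_dual a" "std_part a > 0"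
proof -
  have "conjg (row_col x x) = row_col x x"
    by (rule conjg_row_col)
  then have c: "conjg (inf_part (row_col x x)) = inf_part (row_col x x)"
    by (metis dual_part_conjg(2))
  show ?thesis
  proof
    show "row_col x x = of_dual (Dual (vec_sqnorm (std_vec x)) (Re_q (inf_part (row_col x x))))"
      using quat_self_conjugate[OF c] by (simp add: dual_eq_iff std_part_row_col row_col_self)
    show "std_part (Dual (vec_sqnorm (std_vec x)) (Re_q (inf_part (row_col x x)))) > 0"
      using assms by (simp add: appreciable_vec_iff vec_sqnorm_pos)
  qed
qed

section \<open>Right eigenvalues of Hermitian dual quaternion matrices\<close>

lemma right_eigenvector_form:
  "right_eigenvector A l x \<Longrightarrow> row_col x (A *v x) = row_col x x * l"
  by (simp add: right_eigenvector_def row_col_rscale_right)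

lemma right_eigenvector_std:
  "right_eigenvector A l x \<Longrightarrow>
    std_vec x \<noteq> 0 \<and> std_mat A *v std_vec x = vec_rscale (std_vec x) (std_part l)"
  by (metis appreciable_vec_iff right_eigenvector_def std_vec_mult std_vec_rscale)

text \<open>Here \<open>l\<close> is a priori only a dual quaternion. Comparing parts gives a
  triangular system with real data: the standard part determines \<open>l0\<close>, then the
  infinitesimal part determines \<open>l1\<close>. A nonzero real can be cancelled among the
  quaternions, so \<open>l\<close> has these parts.\<close>

lemma dual_divide:
  fixes a b :: "real dual"
  assumes "std_part a \<noteq> 0" and "of_dual a * l = of_dual b"
  shows "\<exists>d. l = of_dual d"
proof -
  define l0 where "l0 = std_part b / std_part a"
  define l1 where "l1 = (inf_part b - inf_part a * l0) / std_part a"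
  have a: "of_real (std_part a) \<noteq> (0::quat)"
    using assms(1) by simp
  have 0: "of_real (std_part a) * std_part l = of_real (std_part b)"
    and 1: "of_real (std_part a) * inf_part l + of_real (inf_part a) * std_part l
      = of_real (inf_part b)"
    using assms(2) by (simp_all add: dual_eq_iff)
  have "of_real (std_part a) * std_part l = of_real (std_part a * l0)"
    using 0 assms(1) by (simp add: l0_def)
  then have l0: "std_part l = of_real l0"
    using a by simp
  have "of_real (std_part a) * inf_part l = of_real (inf_part b - inf_part a * l0)"
    using 1 by (simp add: l0 eq_diff_eq)
  also have "\<dots> = of_real (std_part a * l1)"
    using assms(1) by (simp add: l1_def)
  finally have "inf_part l = of_real l1"
    using a by simp
  with l0 show ?thesis
    by (intro exI[of _ "Dual l0 l1"]) (simp add: dual_eq_iff)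
qed

lemma right_eigenvalue_dual_number:
  assumes "hermitian A" and "right_eigenvalue A l"
  shows "\<exists>d. l = of_dual d \<and> eigenvalue A d"
proof -
  obtain x where x: "right_eigenvector A l x"
    using assms(2) by (auto simp: right_eigenvalue_def)
  obtain a where a: "row_col x x = of_dual a" "std_part a > 0"
    using x row_col_self_of_dual by (auto simp: right_eigenvector_def)
  obtain b where b: "row_col x (A *v x) = of_dual b"
    using dual_form_dual_number[OF assms(1)] by blast
  have "of_dual a * l = of_dual b"
    using right_eigenvector_form[OF x] a b by simp
  then show ?thesis
    using dual_divide[of a l b] a(2) assms(2) by (auto simp: eigenvalue_def)
qed

text \<open>First-order perturbation: take the infinitesimal part of the eigenvalue equation and
  pair it with \<open>std_vec x\<close>. The terms containing \<open>inf_vec x\<close> cancel,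
  because the Hermitian \<open>std_mat A\<close> can be moved onto \<open>std_vec x\<close>, its own
  eigenvector for a real eigenvalue.\<close>

lemma eigenvalue_inf_part:
  assumes "hermitian A" and "eigenvector A d x"
  shows "of_real (inf_part d) =
    row_col (std_vec x) (inf_mat A *v std_vec x) / row_col (std_vec x) (std_vec x)"
proof -
  let ?y = "std_vec x" and ?z = "inf_vec x"
  have x: "right_eigenvector A (of_dual d) x"
    using assms(2) by (simp add: eigenvector_def)
  have y: "?y \<noteq> 0" "std_mat A *v ?y = vec_rscale ?y (of_real (std_part d))"
    using right_eigenvector_std[OF x] by simp_all
  have "std_mat A *v ?z + inf_mat A *v ?y
      = vec_rscale ?y (of_real (inf_part d)) + vec_rscale ?z (of_real (std_part d))"
    using x by (metis inf_vec_mult inf_vec_rscale of_dual_parts right_eigenvector_def)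
  then have "row_col ?y (std_mat A *v ?z) + row_col ?y (inf_mat A *v ?y)
      = row_col ?y ?y * of_real (inf_part d) + row_col ?y ?z * of_real (std_part d)"
    by (metis row_col_add_right row_col_rscale_right)
  moreover have "row_col ?y (std_mat A *v ?z) = row_col ?y ?z * of_real (std_part d)"
    by (simp add: hermitian_row_col[OF hermitian_std_mat[OF assms(1)]] y(2)
        row_col_rscale_left of_real_mult_commute_quat)
  ultimately have "row_col ?y (inf_mat A *v ?y) = of_real (inf_part d) * row_col ?y ?y"
    by (metis add.commute add_left_cancel of_real_mult_commute_quat)
  then show ?thesis
    using vec_sqnorm_pos[OF y(1)] by (simp add: row_col_self nonzero_eq_divide_eq)
qed

lemma eigenvectors_std_orthogonal:
  assumes "hermitian A" "eigenvector A d x" "eigenvector A e y" "d \<noteq> e"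
  shows "row_col (std_vec x) (std_vec y) = 0"
proof -
  let ?z = "row_col x y"
  have "?z * of_dual e = row_col x (A *v y)"
    using assms(3) by (simp add: eigenvector_def right_eigenvector_def row_col_rscale_right)
  also have "\<dots> = of_dual d * ?z"
    using assms(2) by (simp add: hermitian_row_col[OF assms(1)] eigenvector_def
        right_eigenvector_def row_col_rscale_left)
  finally have eq: "?z * of_dual e = of_dual d * ?z" .
  have 0: "of_real (std_part e - std_part d) * std_part ?z = 0"
    using arg_cong[OF eq, of std_part] by (simp add: of_real_mult_commute_quat algebra_simps)
  have "std_part ?z = 0"
  proof (cases "std_part d = std_part e")
    case True
    \<comment> \<open>In the infinitesimal part of \<open>eq\<close>, the unknown
      \<open>inf_part ?z\<close> is multiplied by the difference of the standard parts, which
      vanishes in this case.\<close>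
    then have "of_real (inf_part e - inf_part d) * std_part ?z = 0"
      using arg_cong[OF eq, of inf_part]
      by (simp add: of_real_mult_commute_quat algebra_simps)
    with True assms(4) show ?thesis
      by (auto simp: dual_eq_iff simp flip: of_real_diff)
  next
    case False
    with 0 show ?thesis
      by (auto simp flip: of_real_diff)
  qed
  then show ?thesis
    by (simp add: std_part_row_col)
qed

lemma eigenvalues_card:
  fixes A :: "quat dual ^ 'n ^ 'n"
  assumes "hermitian A"
  shows "finite {d. eigenvalue A d} \<and> card {d. eigenvalue A d} \<le> CARD('n)"
\<comment> \<open>Bounding every finite set of eigenvalues gives finiteness of the full set and the
  bound at once.\<close>
proof (rule finite_if_finite_subsets_card_bdd)
  fix S assume S: "S \<subseteq> {d. eigenvalue A d}" "finite S"
  then have "\<forall>d\<in>S. \<exists>x. eigenvector A d x"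
    by (auto simp: eigenvalue_def eigenvector_def right_eigenvalue_def)
  then obtain x where x: "\<And>d. d \<in> S \<Longrightarrow> eigenvector A d (x d)"
    by metis
  show "card S \<le> CARD('n)"
    using S(2)
  proof (rule card_orthogonal_le)
    show "std_vec (x d) \<noteq> 0" if "d \<in> S" for d
      using x[OF that] by (simp add: eigenvector_def right_eigenvector_std)
  qed (use eigenvectors_std_orthogonal[OF assms] x in blast)
qed

section \<open>Signs of eigenvalues and definiteness of the standard part\<close>

lemma eigenvalue_quotient:
  assumes "eigenvalue A d"
  obtains x a where "appreciable_vec x" "std_part a > 0" "row_col x (A *v x) = of_dual (a * d)"
proof -
  obtain x where x: "right_eigenvector A (of_dual d) x"
    using assms by (auto simp: eigenvalue_def right_eigenvalue_def)
  then have "appreciable_vec x"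
    by (simp add: right_eigenvector_def)
  \<comment> \<open>The factor \<open>a\<close> is \<open>row_col x x\<close>: a Rayleigh quotient
    in product form.\<close>
  with x show ?thesis
    by (metis of_dual_mult right_eigenvector_form row_col_self_of_dual that)
qed

lemma dual_psd_eigenvalue:
  assumes "dual_psd A" "eigenvalue A d"
  shows "d \<ge> 0"
proof -
  obtain x a where a: "std_part a > 0" "row_col x (A *v x) = of_dual (a * d)"
    using eigenvalue_quotient[OF assms(2)] by blast
  then have "a * d \<ge> 0"
    using assms(1) by (metis dual_psd_def of_dual_eq_iff)
  then show ?thesis
    \<comment> \<open>Since \<open>a\<close> has positive standard part, \<open>a * d\<close> and
      \<open>d\<close> have standard parts of the same sign; if these vanish, the infinitesimal part
      of \<open>a * d\<close> is that of \<open>d\<close> times \<open>std_part a\<close>.\<close>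
    using a(1) by (auto simp: less_eq_dual_def zero_less_mult_iff zero_le_mult_iff)
qed

lemma dual_pd_eigenvalue:
  assumes "dual_pd A" "eigenvalue A d"
  shows "appreciable d \<and> d > 0"
proof -
  obtain x a where a: "appreciable_vec x" "std_part a > 0" "row_col x (A *v x) = of_dual (a * d)"
    using eigenvalue_quotient[OF assms(2)] by blast
  then have "a * d > 0 \<and> appreciable (a * d)"
    using assms(1) by (metis dual_pd_def of_dual_eq_iff)
  then show ?thesis
    using a(2) by (auto simp: less_dual_def less_eq_dual_def appreciable_def zero_less_mult_iff)
qed

lemma std_form:
  "row_col x (A *v x) = of_dual d \<Longrightarrow>
    row_col (std_vec x) (std_mat A *v std_vec x) = of_real (std_part d)"
  by (metis of_dual_parts(1) std_part_row_col std_vec_mult)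

text \<open>Any lift of a quaternion vector to a dual one will do: the standard part of the form
  depends only on the standard vector, and the lexicographic order makes the standard part of a
  nonnegative dual number nonnegative.\<close>

lemma dual_psd_std:
  fixes A :: "quat dual ^ 'n ^ 'n"
  assumes "dual_psd A"
  shows "quat_psd (std_mat A)"
  unfolding quat_psd_def
proof (intro conjI allI)
  show "hermitian (std_mat A)"
    using assms by (simp add: dual_psd_def hermitian_std_mat)
  fix x :: "quat ^ 'n"
  obtain y :: "quat dual ^ 'n" where y: "std_vec y = x"
    using std_vec_surj by blast
  obtain d where "row_col y (A *v y) = of_dual d" "d \<ge> 0"
    using assms by (auto simp: dual_psd_def)
  then show "\<exists>r. row_col x (std_mat A *v x) = of_real r \<and> r \<ge> 0"
    using std_form y by (intro exI[of _ "std_part d"]) (auto simp: less_eq_dual_def)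
qed

lemma dual_pd_std:
  fixes A :: "quat dual ^ 'n ^ 'n"
  assumes "dual_pd A"
  shows "quat_pd (std_mat A)"
  unfolding quat_pd_def
proof (intro conjI allI impI)
  show "hermitian (std_mat A)"
    using assms by (simp add: dual_pd_def hermitian_std_mat)
  fix x :: "quat ^ 'n" assume "x \<noteq> 0"
  moreover obtain y :: "quat dual ^ 'n" where y: "std_vec y = x"
    using std_vec_surj by blast
  ultimately obtain d where "row_col y (A *v y) = of_dual d" "d > 0" "appreciable d"
    using assms by (auto simp: dual_pd_def appreciable_vec_iff)
  \<comment> \<open>Positivity of \<open>d\<close> gives only a nonnegative standard part, as
    positive multiples of the infinitesimal unit show; appreciability makes it strict.\<close>
  then show "\<exists>r. row_col x (std_mat A *v x) = of_real r \<and> r > 0"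
    using std_form y
    by (intro exI[of _ "std_part d"]) (auto simp: less_dual_def less_eq_dual_def appreciable_def)
qed

theorem theorem3p3:
  fixes A :: "quat dual ^ 'n ^ 'n"
  assumes "hermitian A" and "std_mat A \<noteq> 0"
  shows
    "((\<forall>l. right_eigenvalue A l \<longrightarrow>
         (\<exists>d. l = of_dual d \<and> eigenvalue A d) \<and>
         quat_right_eigenvalue (std_mat A) (std_part l)) \<and>
      hermitian (std_mat A) \<and>
      (\<forall>d x. eigenvector A d x \<longrightarrow>
         of_real (inf_part d) =
           row_col (std_vec x) (inf_mat A *v std_vec x) / row_col (std_vec x) (std_vec x)))
   \<and> (finite {d. eigenvalue A d} \<and> card {d. eigenvalue A d} \<le> CARD('n) \<and>
      (\<forall>l. right_eigenvalue A l \<longrightarrow> l \<in> of_dual ` {d. eigenvalue A d}))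
   \<and> (dual_psd A \<longrightarrow> (\<forall>d. eigenvalue A d \<longrightarrow> d \<ge> 0) \<and> quat_psd (std_mat A))
   \<and> (dual_pd A \<longrightarrow> (\<forall>d. eigenvalue A d \<longrightarrow> appreciable d \<and> d > 0) \<and> quat_pd (std_mat A))"
proof (intro conjI allI impI)
  show "\<exists>d. l = of_dual d \<and> eigenvalue A d" if "right_eigenvalue A l" for l
    using right_eigenvalue_dual_number[OF assms(1) that] .
  then show "l \<in> of_dual ` {d. eigenvalue A d}" if "right_eigenvalue A l" for l
    using that by blast
  show "quat_right_eigenvalue (std_mat A) (std_part l)" if "right_eigenvalue A l" for l
    using that right_eigenvector_std
    by (fastforce simp: right_eigenvalue_def quat_right_eigenvalue_def)
  show "finite {d. eigenvalue A d}" "card {d. eigenvalue A d} \<le> CARD('n)"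
    using eigenvalues_card[OF assms(1)] by auto
qed (fact hermitian_std_mat[OF assms(1)] eigenvalue_inf_part[OF assms(1)] dual_psd_eigenvalue
    dual_psd_std dual_pd_eigenvalue[THEN conjunct1] dual_pd_eigenvalue[THEN conjunct2]
    dual_pd_std)+

end
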